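(* Let $\widetilde{G}:Sp(2n,\mathbb{R})\to\mathbb{R}$ be a smooth function and let $G:Gl(2n,\mathbb{R})\to\mathbb{R}$ be a smooth function with $G|_{Sp(2n,\mathbb{R})}=\widetilde{G}$. Let $M\in Sp(2n,\mathbb{R})$ and $X_M,Y_M\in T_MSp(2n,\mathbb{R})$ with $X_M=MX_0=MJS_X$ and $Y_M=MY_0=MJS_Y$, where $S_X,S_Y\in Sym(2n,\mathbb{R})$. The Hessian at $M$ of $\widetilde{G}$ with respect to the Riemannian metric induced on $Sp(2n,\mathbb{R})$ by the left invariant metric $\langle\cdot,\cdot\rangle_{Inv}$ of $Gl(2n,\mathbb{R})$ is given by $$\mathrm{Hess}_{Inv}\widetilde{G}(X_M,Y_M)=\left(\mathrm{Hess}_{Euc}G-\widetilde{\Gamma}(M)\otimes J\right)(X_M,Y_M)+\left\langle\nabla_{Euc}G(M)+JM\widetilde{\Gamma}(M),MZ_{(X_0,Y_0)}\right\rangle_{Euc},$$ where $$\widetilde{\Gamma}(M)=\frac{1}{2}\left(JM^T\nabla_{Euc}G(M)+\nabla_{Euc}G(M)^TMJ\right)$$ and $$Z_{(X_0,Y_0)}=\frac{1}{2}\left(X_0Y_0+Y_0X_0+[Y_0^T,X_0]+[X_0^T,Y_0]\right).$$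
   Context: $\mathcal{M}_{2n}(\mathbb{R})$ is the space of real $2n\times 2n$ matrices with the Frobenius inner product $\langle X,Y\rangle_{Euc}=\mathrm{tr}(X^TY)$; $Gl(2n,\mathbb{R})$ is its open subset of invertible matrices; $Sym(2n,\mathbb{R})$ is the space of symmetric matrices. $J=\begin{bmatrix}0&\mathbb{I}_n\\-\mathbb{I}_n&0\end{bmatrix}$, $Sp(2n,\mathbb{R})=\{M\in\mathcal{M}_{2n}(\mathbb{R}) : M^TJM=J\}$, and $T_MSp(2n,\mathbb{R})=\{MJS : S\in Sym(2n,\mathbb{R})\}$. $\nabla_{Euc}G(M)$ is the gradient for $\langle\cdot,\cdot\rangle_{Euc}$ and $\mathrm{Hess}_{Euc}G$ is the ordinary second derivative of $G$ at $M$ as a bilinear form. The left invariant metric is $\langle X_M,Y_M\rangle_{Inv}=\mathrm{tr}(X_M^TM^{-T}M^{-1}Y_M)$ for $X_M,Y_M\in T_MGl(2n,\mathbb{R})$. $\mathrm{Hess}_{Inv}\widetilde{G}$ is the Riemannian Hessian (bilinear form) of $\widetilde{G}$ on $Sp(2n,\mathbb{R})$ for the induced metric. For $2n\times 2n$ matrices $X,Y$, the Kronecker product $Y\otimes X$ is identified with the bilinear form $(U,V)\mapsto\mathrm{vec}(U)^T(Y\otimes X)\mathrm{vec}(V)=\mathrm{tr}(U^TXVY^T)$, with $\mathrm{vec}$ the column vectorization. $[X,Y]=XY-YX$. *)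

theory Defs
  imports "HOL-Analysis.Analysis"
begin

section \<open>Smooth functions\<close>

text \<open>Meant for open \<open>U\<close>; since the domain is finite-dimensional, asking for all directional
  derivatives to be of class \<open>C^k\<close> is the same as asking it of the total derivative.\<close>

primrec Ck_on :: "nat \<Rightarrow> 'a::euclidean_space set \<Rightarrow> ('a \<Rightarrow> 'b::real_normed_vector) \<Rightarrow> bool" where
  "Ck_on 0 U f \<longleftrightarrow> continuous_on U f"
| "Ck_on (Suc k) U f \<longleftrightarrow> (\<forall>x\<in>U. f differentiable (at x)) \<and>
     (\<forall>v. Ck_on k U (\<lambda>x. frechet_derivative f (at x) v))"

text \<open>Smoothness on a subset of a Euclidean space: local smooth extensions exist. On an open
  set this is the usual notion, on an embedded submanifold it is smoothness in charts.\<close>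

definition smooth_on :: "'a::euclidean_space set \<Rightarrow> ('a \<Rightarrow> 'b::real_normed_vector) \<Rightarrow> bool" where
  "smooth_on S f \<longleftrightarrow> (\<forall>x\<in>S. \<exists>U h. open U \<and> x \<in> U \<and> (\<forall>k. Ck_on k U h) \<and> (\<forall>y\<in>S \<inter> U. h y = f y))"


section \<open>Riemannian geometry of an embedded submanifold\<close>

text \<open>A Riemannian manifold is given by an embedded submanifold \<open>S\<close> of a Euclidean space, its
  tangent spaces \<open>T x\<close> and a metric \<open>g x\<close> on each \<open>T x\<close>. Functions and vector fields on \<open>S\<close>
  are total functions on the ambient space whose values off \<open>S\<close> are irrelevant.\<close>

text \<open>The derivative relative to \<open>S\<close> is unique only on tangent vectors, so this is meaningful
  for \<open>x \<in> S\<close> and \<open>v\<close> tangent to \<open>S\<close> at \<open>x\<close>; there it is the differential of \<open>f\<close>.\<close>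

definition dir_deriv ::
  "'a::euclidean_space set \<Rightarrow> ('a \<Rightarrow> 'b::real_normed_vector) \<Rightarrow> 'a \<Rightarrow> 'a \<Rightarrow> 'b" where
  "dir_deriv S f x v = frechet_derivative f (at x within S) v"

definition vector_fields ::
  "'a::euclidean_space set \<Rightarrow> ('a \<Rightarrow> 'a set) \<Rightarrow> ('a \<Rightarrow> 'a) set" where
  "vector_fields S T = {X. smooth_on S X \<and> (\<forall>x\<in>S. X x \<in> T x)}"

definition lie_bracket ::
  "'a::euclidean_space set \<Rightarrow> ('a \<Rightarrow> 'a) \<Rightarrow> ('a \<Rightarrow> 'a) \<Rightarrow> 'a \<Rightarrow> 'a" where
  "lie_bracket S X Y x = dir_deriv S Y x (X x) - dir_deriv S X x (Y x)"

text \<open>\<open>D x v Y\<close> stands for the covariant derivative at \<open>x\<close> of the field \<open>Y\<close> in the direction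
  \<open>v \<in> T x\<close>. Taking a tangent vector rather than a field as the direction encodes linearity
  over smooth functions in that argument.\<close>

definition is_connection ::
  "'a::euclidean_space set \<Rightarrow> ('a \<Rightarrow> 'a set) \<Rightarrow> ('a \<Rightarrow> 'a \<Rightarrow> ('a \<Rightarrow> 'a) \<Rightarrow> 'a) \<Rightarrow> bool" where
  "is_connection S T D \<longleftrightarrow>
     (\<forall>X\<in>vector_fields S T. \<forall>Y\<in>vector_fields S T. (\<lambda>x. D x (X x) Y) \<in> vector_fields S T) \<and>
     (\<forall>x\<in>S. \<forall>v\<in>T x. \<forall>w\<in>T x. \<forall>a b. \<forall>Y\<in>vector_fields S T.
        D x (a *\<^sub>R v + b *\<^sub>R w) Y = a *\<^sub>R D x v Y + b *\<^sub>R D x w Y) \<and>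
     (\<forall>x\<in>S. \<forall>v\<in>T x. \<forall>Y\<in>vector_fields S T. \<forall>Z\<in>vector_fields S T.
        D x v (\<lambda>y. Y y + Z y) = D x v Y + D x v Z) \<and>
     (\<forall>x\<in>S. \<forall>v\<in>T x. \<forall>f::'a \<Rightarrow> real. \<forall>Y\<in>vector_fields S T. smooth_on S f \<longrightarrow>
        D x v (\<lambda>y. f y *\<^sub>R Y y) = dir_deriv S f x v *\<^sub>R Y x + f x *\<^sub>R D x v Y)"

definition is_levi_civita ::
  "'a::euclidean_space set \<Rightarrow> ('a \<Rightarrow> 'a set) \<Rightarrow> ('a \<Rightarrow> 'a \<Rightarrow> 'a \<Rightarrow> real) \<Rightarrow>
     ('a \<Rightarrow> 'a \<Rightarrow> ('a \<Rightarrow> 'a) \<Rightarrow> 'a) \<Rightarrow> bool" where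
  "is_levi_civita S T g D \<longleftrightarrow> is_connection S T D \<and>
     (\<forall>x\<in>S. \<forall>X\<in>vector_fields S T. \<forall>Y\<in>vector_fields S T.
        D x (X x) Y - D x (Y x) X = lie_bracket S X Y x) \<and>
     (\<forall>x\<in>S. \<forall>v\<in>T x. \<forall>Y\<in>vector_fields S T. \<forall>Z\<in>vector_fields S T.
        dir_deriv S (\<lambda>y. g y (Y y) (Z y)) x v = g x (D x v Y) (Z x) + g x (Y x) (D x v Z))"

text \<open>A choice operator because uniqueness holds only at points of \<open>S\<close>, on tangent vectors and
  on vector fields; elsewhere the value of a connection is arbitrary.\<close>

definition levi_civita ::
  "'a::euclidean_space set \<Rightarrow> ('a \<Rightarrow> 'a set) \<Rightarrow> ('a \<Rightarrow> 'a \<Rightarrow> 'a \<Rightarrow> real) \<Rightarrow>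
     'a \<Rightarrow> 'a \<Rightarrow> ('a \<Rightarrow> 'a) \<Rightarrow> 'a" where
  "levi_civita S T g = (SOME D. is_levi_civita S T g D)"

definition riem_grad ::
  "'a::euclidean_space set \<Rightarrow> ('a \<Rightarrow> 'a set) \<Rightarrow> ('a \<Rightarrow> 'a \<Rightarrow> 'a \<Rightarrow> real) \<Rightarrow> ('a \<Rightarrow> real) \<Rightarrow> 'a \<Rightarrow> 'a" where
  "riem_grad S T g f x = (THE u. u \<in> T x \<and> (\<forall>w\<in>T x. g x u w = dir_deriv S f x w))"

definition riem_hess ::
  "'a::euclidean_space set \<Rightarrow> ('a \<Rightarrow> 'a set) \<Rightarrow> ('a \<Rightarrow> 'a \<Rightarrow> 'a \<Rightarrow> real) \<Rightarrow> ('a \<Rightarrow> real) \<Rightarrow>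
     'a \<Rightarrow> 'a \<Rightarrow> 'a \<Rightarrow> real" where
  "riem_hess S T g f x v w = g x (levi_civita S T g x v (riem_grad S T g f)) w"


section \<open>Matrices\<close>

text \<open>The index set \<open>{1..2n}\<close> is \<open>'n + 'n\<close>: \<open>Inl\<close> is the first block of \<open>n\<close> indices, \<open>Inr\<close> the
  second.\<close>

type_synonym 'n mat2n = "real^('n + 'n)^('n + 'n)"

definition J :: "'n::finite mat2n" where
  "J = (\<chi> i j. case (i, j) of
     (Inl a, Inr b) \<Rightarrow> if a = b then 1 else 0
   | (Inr a, Inl b) \<Rightarrow> if a = b then -1 else 0
   | _ \<Rightarrow> 0)"

definition Gl :: "'n::finite mat2n set" where
  "Gl = {M. invertible M}"

definition Sym :: "'n::finite mat2n set" where
  "Sym = {S. transpose S = S}"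

definition Sp :: "'n::finite mat2n set" where
  "Sp = {M. transpose M ** J ** M = J}"

definition T_Sp :: "'n::finite mat2n \<Rightarrow> 'n mat2n set" where
  "T_Sp M = {M ** J ** S | S. S \<in> Sym}"

definition inner_Euc :: "real^'m^'n \<Rightarrow> real^'m^'n \<Rightarrow> real" where
  "inner_Euc X Y = trace (transpose X ** Y)"

definition inner_Inv :: "'n::finite mat2n \<Rightarrow> 'n mat2n \<Rightarrow> 'n mat2n \<Rightarrow> real" where
  "inner_Inv M X Y = trace (transpose X ** transpose (matrix_inv M) ** matrix_inv M ** Y)"

definition grad_Euc :: "('n::finite mat2n \<Rightarrow> real) \<Rightarrow> 'n mat2n \<Rightarrow> 'n mat2n" where
  "grad_Euc G M = (THE A. (G has_derivative (\<lambda>V. inner_Euc A V)) (at M))"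

definition Hess_Euc :: "('n::finite mat2n \<Rightarrow> real) \<Rightarrow> 'n mat2n \<Rightarrow> 'n mat2n \<Rightarrow> 'n mat2n \<Rightarrow> real" where
  "Hess_Euc G M U V = frechet_derivative (\<lambda>N. frechet_derivative G (at N) V) (at M) U"

definition Hess_Inv :: "('n::finite mat2n \<Rightarrow> real) \<Rightarrow> 'n mat2n \<Rightarrow> 'n mat2n \<Rightarrow> 'n mat2n \<Rightarrow> real" where
  "Hess_Inv = riem_hess Sp T_Sp inner_Inv"

text \<open>Column vectorization: an entry of \<open>vectorize U\<close> is indexed by a pair (column, row) of
  \<open>U\<close>. In the Kronecker product the first components index the left factor.\<close>

definition vectorize :: "real^'m^'n \<Rightarrow> real^('m \<times> 'n)" where
  "vectorize U = (\<chi> p. U $ snd p $ fst p)"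

definition kron :: "real^'b^'a \<Rightarrow> real^'d^'c \<Rightarrow> real^('b \<times> 'd)^('a \<times> 'c)" where
  "kron A B = (\<chi> p q. A $ fst p $ fst q * B $ snd p $ snd q)"

definition kron_form :: "'n::finite mat2n \<Rightarrow> 'n mat2n \<Rightarrow> 'n mat2n \<Rightarrow> 'n mat2n \<Rightarrow> real" where
  "kron_form Y X U V = vectorize U \<bullet> (kron Y X *v vectorize V)"

definition commutator :: "'n::finite mat2n \<Rightarrow> 'n mat2n \<Rightarrow> 'n mat2n" where
  "commutator X Y = X ** Y - Y ** X"

definition Gamma_tilde :: "('n::finite mat2n \<Rightarrow> real) \<Rightarrow> 'n mat2n \<Rightarrow> 'n mat2n" where
  "Gamma_tilde G M =
     (1/2) *\<^sub>R (J ** transpose M ** grad_Euc G M + transpose (grad_Euc G M) ** M ** J)"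

definition Z_term :: "'n::finite mat2n \<Rightarrow> 'n mat2n \<Rightarrow> 'n mat2n" where
  "Z_term X0 Y0 = (1/2) *\<^sub>R (X0 ** Y0 + Y0 ** X0
     + commutator (transpose Y0) X0 + commutator (transpose X0) Y0)"

lemma kron_form_eq_trace:
  fixes X Y U V :: "'n::finite mat2n"
  shows "kron_form Y X U V = trace (transpose U ** X ** V ** transpose Y)"
proof -
  have prod: "(\<Sum>p\<in>UNIV. f p) = (\<Sum>a\<in>UNIV. \<Sum>b\<in>UNIV. f (a, b))"
    for f :: "('n + 'n) \<times> ('n + 'n) \<Rightarrow> real"
    by (simp add: sum.cartesian_product flip: UNIV_Times_UNIV)
  have "kron_form Y X U V =
      (\<Sum>j\<in>UNIV. \<Sum>i\<in>UNIV. \<Sum>l\<in>UNIV. \<Sum>k\<in>UNIV. U$i$j * (Y$j$l * X$i$k * V$k$l))"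
    unfolding kron_form_def vectorize_def kron_def inner_vec_def matrix_vector_mult_def
    by (simp add: prod sum_distrib_left)
  also have "\<dots> = (\<Sum>j\<in>UNIV. \<Sum>l\<in>UNIV. \<Sum>k\<in>UNIV. \<Sum>i\<in>UNIV. U$i$j * (Y$j$l * X$i$k * V$k$l))"
    apply (rule sum.cong[OF refl])
    apply (rule trans[OF sum.swap])
    apply (rule sum.cong[OF refl])
    by (rule sum.swap)
  also have "\<dots> = trace (transpose U ** X ** V ** transpose Y)"
    unfolding trace_def transpose_def matrix_matrix_mult_def
    by (simp add: sum_distrib_right sum_distrib_left mult_ac)
  finally show ?thesis .
qed

end

theory Submission
  imports Defs
begin

text \<open>In left trivialisation (a field \<open>Y\<close> becomes the \<open>sp\<close>-valued function \<open>N\<^sup>-\<^sup>1 Y N\<close>, and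
  \<open>N\<^sup>-\<^sup>1 = - J N\<^sup>T J\<close> is linear in \<open>N\<close>) the Levi-Civita connection is the ordinary derivative
  plus an algebraic term \<open>lie_conn\<close>. Extending the second argument to the left invariant field
  \<open>W N = N Y\<^sub>0\<close>, metric compatibility gives \<open>Hess (X, W) = X (W G) - (D\<^sub>X W) G\<close>, that is
  \<open>Hess_Euc G + \<langle>grad G, M (X\<^sub>0 Y\<^sub>0 - lie_conn X\<^sub>0 Y\<^sub>0)\<rangle>\<close>, and the bracket is \<open>Z_term X\<^sub>0 Y\<^sub>0\<close>.
  The two terms with \<open>\<Gamma>\<close> in the stated formula cancel.\<close>

section \<open>Differential calculus of smooth maps\<close>

lemma Ck_on_Suc_imp: "Ck_on (Suc k) U f \<Longrightarrow> Ck_on k U f"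
proof (induction k arbitrary: f)
  case 0
  then show ?case
    by (auto intro!: continuous_at_imp_continuous_on differentiable_imp_continuous_within)
next
  case (Suc k)
  then show ?case by fastforce
qed

lemma Ck_on_mono: "Ck_on k U f \<Longrightarrow> V \<subseteq> U \<Longrightarrow> Ck_on k V f"
  by (induction k arbitrary: f) (auto intro: continuous_on_subset)

text \<open>Openness makes \<open>f\<close> and \<open>g\<close> agree near each point, so their
  derivatives agree too and the induction can pass to these. The closure lemmas use it to trade
  \<open>frechet_derivative\<close> for an explicit formula.\<close>

lemma Ck_on_cong:
  assumes "open U" "\<And>x. x \<in> U \<Longrightarrow> f x = g x" "Ck_on k U f"
  shows "Ck_on k U g"
  using assms(2,3)
proof (induction k arbitrary: f g)
  case 0
  then show ?case by (metis Ck_on.simps(1) continuous_on_cong)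
next
  case (Suc k)
  have d: "(g has_derivative frechet_derivative f (at x)) (at x)" if "x \<in> U" for x
    using Suc.prems that assms(1)
    by (auto simp: frechet_derivative_works intro: has_derivative_transform_within_open)
  have "Ck_on k U (\<lambda>x. frechet_derivative g (at x) v)" for v
    by (rule Suc.IH[of "\<lambda>x. frechet_derivative f (at x) v"])
      (use Suc.prems in \<open>auto simp: frechet_derivative_at[OF d]\<close>)
  with d show ?case by (auto simp: differentiable_def)
qed

lemma Ck_on_add:
  assumes "open U" "Ck_on k U f" "Ck_on k U g"
  shows "Ck_on k U (\<lambda>x. f x + g x)"
  using assms(2,3)
proof (induction k arbitrary: f g)
  case 0
  then show ?case by (auto intro: continuous_on_add)
next
  case (Suc k)
  have d: "((\<lambda>x. f x + g x) has_derivative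
      (\<lambda>v. frechet_derivative f (at x) v + frechet_derivative g (at x) v)) (at x)" if "x \<in> U" for x
    using Suc.prems that by (intro has_derivative_add) (auto simp: frechet_derivative_works)
  have "Ck_on k U (\<lambda>x. frechet_derivative (\<lambda>x. f x + g x) (at x) v)" for v
    by (rule Ck_on_cong[OF assms(1) _ Suc.IH[of "\<lambda>x. frechet_derivative f (at x) v"
            "\<lambda>x. frechet_derivative g (at x) v"]])
      (use Suc.prems in \<open>auto simp: frechet_derivative_at[OF d, symmetric]\<close>)
  with d show ?case by (auto simp: differentiable_def)
qed

text \<open>By the product rule each directional derivative is a sum of two expressions of the same
  bilinear shape, one order lower.\<close>

lemma Ck_on_bilinear:
  assumes "bounded_bilinear p" "open U" "Ck_on k U f" "Ck_on k U g"
  shows "Ck_on k U (\<lambda>x. p (f x) (g x))"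
  using assms(3,4)
proof (induction k arbitrary: f g)
  case 0
  then show ?case by (auto intro: bounded_bilinear.continuous_on[OF assms(1)])
next
  case (Suc k)
  interpret bounded_bilinear p by fact
  have d: "((\<lambda>x. p (f x) (g x)) has_derivative
      (\<lambda>v. p (f x) (frechet_derivative g (at x) v) + p (frechet_derivative f (at x) v) (g x))) (at x)"
    if "x \<in> U" for x
    using Suc.prems that by (intro FDERIV) (auto simp: frechet_derivative_works)
  have "Ck_on k U (\<lambda>x. frechet_derivative (\<lambda>x. p (f x) (g x)) (at x) v)" for v
    by (rule Ck_on_cong[OF assms(2) _ Ck_on_add[OF assms(2) Suc.IH[of f "\<lambda>x. frechet_derivative g (at x) v"]
            Suc.IH[of "\<lambda>x. frechet_derivative f (at x) v" g]]])
      (use Suc.prems in \<open>auto simp: frechet_derivative_at[OF d, symmetric] intro: Ck_on_Suc_imp\<close>)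
  with d show ?case by (auto simp: differentiable_def)
qed

lemma Ck_on_const: "Ck_on k U (\<lambda>x. c)"
proof (induction k arbitrary: c)
  case (Suc k)
  then show ?case by simp
qed simp

lemma Ck_on_ident: "Ck_on k U (\<lambda>x. x)"
  by (cases k) (auto intro: Ck_on_const)

lemma Ck_on_linear:
  assumes "bounded_linear l" "open U" "Ck_on k U f"
  shows "Ck_on k U (\<lambda>x. l (f x))"
proof -
  \<comment> \<open>A linear map is this bilinear map with the scalar frozen at 1, which saves a
    separate induction.\<close>
  have "bounded_bilinear (\<lambda>(r::real) x. r *\<^sub>R l x)"
    by (rule bounded_bilinear.comp[OF bounded_bilinear_scaleR bounded_linear_ident assms(1)])
  from Ck_on_bilinear[OF this assms(2) Ck_on_const[of _ _ 1] assms(3)]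
  show ?thesis by simp
qed

lemma Ck_on_sum:
  assumes "open U" "\<And>i. i \<in> I \<Longrightarrow> Ck_on k U (f i)"
  shows "Ck_on k U (\<lambda>x. \<Sum>i\<in>I. f i x)"
  using assms(2)
  by (induction I rule: infinite_finite_induct) (auto intro: Ck_on_const Ck_on_add assms(1))

lemma linear_basis_sum:
  fixes f :: "'a::euclidean_space \<Rightarrow> 'b::real_vector"
  assumes "linear f"
  shows "f v = (\<Sum>b\<in>Basis. (v \<bullet> b) *\<^sub>R f b)"
proof -
  have "f v = f (\<Sum>b\<in>Basis. (v \<bullet> b) *\<^sub>R b)" by (simp add: euclidean_representation)
  also have "\<dots> = (\<Sum>b\<in>Basis. (v \<bullet> b) *\<^sub>R f b)"
    using assms by (simp add: linear_sum linear_scale)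
  finally show ?thesis .
qed

text \<open>\<open>Ck_on\<close> controls derivatives in constant directions only. A variable
  direction is expanded in the basis, which leaves products of its coordinates with such
  derivatives.\<close>

lemma Ck_on_frechet_derivative:
  fixes f :: "'a::euclidean_space \<Rightarrow> 'b::real_normed_vector"
  assumes "open U" "Ck_on (Suc k) U f" "Ck_on k U X"
  shows "Ck_on k U (\<lambda>x. frechet_derivative f (at x) (X x))"
proof (rule Ck_on_cong[OF assms(1)])
  show "Ck_on k U (\<lambda>x. \<Sum>b\<in>Basis. (X x \<bullet> b) *\<^sub>R frechet_derivative f (at x) b)"
    by (intro Ck_on_sum Ck_on_bilinear[OF bounded_bilinear_scaleR] assms(1)
        Ck_on_linear[OF bounded_linear_inner_left] assms(3)) (use assms(2) in simp)
  fix x assume "x \<in> U"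
  then show "(\<Sum>b\<in>Basis. (X x \<bullet> b) *\<^sub>R frechet_derivative f (at x) b) = frechet_derivative f (at x) (X x)"
    using assms(2) by (intro linear_basis_sum[symmetric] linear_frechet_derivative) auto
qed

lemma Ck_on_local:
  assumes "\<And>x. x \<in> S \<Longrightarrow> \<exists>U. open U \<and> x \<in> U \<and> Ck_on k U f"
  shows "Ck_on k S f"
  using assms
proof (induction k arbitrary: f)
  case 0
  show ?case
    unfolding Ck_on.simps(1)
  proof (rule continuous_at_imp_continuous_on, rule ballI)
    fix x assume "x \<in> S"
    with 0 show "isCont f x" by (metis Ck_on.simps(1) continuous_on_eq_continuous_at)
  qed
next
  case (Suc k)
  then show ?case by simp meson
qed

section \<open>Smoothness on arbitrary subsets via local extensions\<close>

lemma smooth_on_imp_Ck_on: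
  assumes "open S" "smooth_on S f"
  shows "Ck_on k S f"
proof (rule Ck_on_local)
  fix x assume "x \<in> S"
  with assms(2) obtain U h where h: "open U" "x \<in> U" "\<forall>k. Ck_on k U h" "\<forall>y\<in>S \<inter> U. h y = f y"
    unfolding smooth_on_def by blast
  have "Ck_on k (S \<inter> U) f"
    by (rule Ck_on_cong[of _ h]) (use h assms(1) in \<open>auto intro: Ck_on_mono\<close>)
  with h \<open>x \<in> S\<close> assms(1) show "\<exists>U. open U \<and> x \<in> U \<and> Ck_on k U f"
    by (intro exI[of _ "S \<inter> U"]) auto
qed

lemma Ck_on_imp_smooth_on: "open S \<Longrightarrow> (\<And>k. Ck_on k S f) \<Longrightarrow> smooth_on S f"
  unfolding smooth_on_def by blast

lemma smooth_on_subset: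
  assumes "smooth_on S f" "T \<subseteq> S"
  shows "smooth_on T f"
  unfolding smooth_on_def
proof
  fix x assume "x \<in> T"
  with assms obtain U h where "open U" "x \<in> U" "\<forall>k. Ck_on k U h" "\<forall>y\<in>S \<inter> U. h y = f y"
    unfolding smooth_on_def by (meson subsetD)
  with assms(2) show "\<exists>U h. open U \<and> x \<in> U \<and> (\<forall>k. Ck_on k U h) \<and> (\<forall>y\<in>T \<inter> U. h y = f y)"
    by (intro exI[of _ U] exI[of _ h]) auto
qed

lemma smooth_on_cong:
  assumes "smooth_on S f" "\<And>x. x \<in> S \<Longrightarrow> f x = g x"
  shows "smooth_on S g"
  using assms unfolding smooth_on_def by (metis IntD1)

lemma smooth_on_const: "smooth_on S (\<lambda>x. c)"
  unfolding smooth_on_def using Ck_on_const open_UNIV by blast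

lemma smooth_on_ident: "smooth_on S (\<lambda>x. x)"
  unfolding smooth_on_def using Ck_on_ident open_UNIV by blast

lemma smooth_on_bilinear:
  assumes "bounded_bilinear p" "smooth_on S f" "smooth_on S g"
  shows "smooth_on S (\<lambda>x. p (f x) (g x))"
  unfolding smooth_on_def
proof
  fix x assume "x \<in> S"
  with assms obtain U h V k where "open U" "x \<in> U" "\<forall>n. Ck_on n U h" "\<forall>y\<in>S \<inter> U. h y = f y"
    "open V" "x \<in> V" "\<forall>n. Ck_on n V k" "\<forall>y\<in>S \<inter> V. k y = g y"
    unfolding smooth_on_def by metis
  then show "\<exists>U h. open U \<and> x \<in> U \<and> (\<forall>k. Ck_on k U h) \<and> (\<forall>y\<in>S \<inter> U. h y = p (f y) (g y))"
    by (intro exI[of _ "U \<inter> V"] exI[of _ "\<lambda>x. p (h x) (k x)"])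
      (auto intro!: Ck_on_bilinear[OF assms(1)] intro: Ck_on_mono[of _ U] Ck_on_mono[of _ V])
qed

lemma smooth_on_linear:
  assumes "bounded_linear l" "smooth_on S f"
  shows "smooth_on S (\<lambda>x. l (f x))"
proof -
  have "bounded_bilinear (\<lambda>(r::real) x. r *\<^sub>R l x)"
    by (rule bounded_bilinear.comp[OF bounded_bilinear_scaleR bounded_linear_ident assms(1)])
  from smooth_on_bilinear[OF this smooth_on_const[of _ 1] assms(2)]
  show ?thesis by simp
qed

lemma smooth_on_add:
  assumes "smooth_on S f" "smooth_on S g"
  shows "smooth_on S (\<lambda>x. f x + g x)"
  unfolding smooth_on_def
proof
  fix x assume "x \<in> S"
  with assms obtain U h V k where "open U" "x \<in> U" "\<forall>n. Ck_on n U h" "\<forall>y\<in>S \<inter> U. h y = f y"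
    "open V" "x \<in> V" "\<forall>n. Ck_on n V k" "\<forall>y\<in>S \<inter> V. k y = g y"
    unfolding smooth_on_def by metis
  then show "\<exists>U h. open U \<and> x \<in> U \<and> (\<forall>k. Ck_on k U h) \<and> (\<forall>y\<in>S \<inter> U. h y = f y + g y)"
    by (intro exI[of _ "U \<inter> V"] exI[of _ "\<lambda>x. h x + k x"])
      (auto intro!: Ck_on_add intro: Ck_on_mono[of _ U] Ck_on_mono[of _ V])
qed

lemma extension_has_derivative:
  assumes "open U" "x \<in> U" "x \<in> S" "h differentiable (at x)" "\<forall>y\<in>S \<inter> U. h y = f y"
  shows "(f has_derivative frechet_derivative h (at x)) (at x within S)"
proof -
  have "(h has_derivative frechet_derivative h (at x)) (at x within S)"
    using assms(4) by (auto simp: frechet_derivative_works intro: has_derivative_at_withinI)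
  then show ?thesis
    by (rule has_derivative_transform_eventually)
      (use assms in \<open>auto simp: eventually_at_topological\<close>)
qed

lemma smooth_on_differentiable:
  assumes "smooth_on S f" "x \<in> S"
  shows "f differentiable (at x within S)"
proof -
  from assms obtain U h where h: "open U" "x \<in> U" "\<forall>k. Ck_on k U h" "\<forall>y\<in>S \<inter> U. h y = f y"
    unfolding smooth_on_def by blast
  from h(2) h(3)[rule_format, of "Suc 0"] have "h differentiable (at x)" by simp
  from extension_has_derivative[OF h(1,2) assms(2) this h(4)] show ?thesis
    by (rule differentiableI)
qed

section \<open>Matrices\<close>

lemma matrix_mult_component: "(A ** B) $ i $ j = (\<Sum>k\<in>UNIV. A $ i $ k * B $ k $ j)"
  by (simp add: matrix_matrix_mult_def)

lemma bounded_bilinear_matrix_mult: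
  "bounded_bilinear ((**) :: real^'m^'n \<Rightarrow> real^'k^'m \<Rightarrow> real^'k^'n)"
  unfolding bilinear_conv_bounded_bilinear[symmetric] bilinear_def linear_iff
  by (simp add: vec_eq_iff matrix_mult_component sum.distrib ring_distribs sum_distrib_left mult_ac)

interpretation matmul: bounded_bilinear "(**) :: real^'m^'n \<Rightarrow> real^'k^'m \<Rightarrow> real^'k^'n"
  by (rule bounded_bilinear_matrix_mult)

lemma bounded_linear_transpose: "bounded_linear (transpose :: real^'m^'n \<Rightarrow> real^'n^'m)"
  unfolding linear_conv_bounded_linear[symmetric] linear_iff
  by (simp add: vec_eq_iff transpose_def)

lemmas transpose_simps = linear_0[OF bounded_linear.linear[OF bounded_linear_transpose]]
  linear_add[OF bounded_linear.linear[OF bounded_linear_transpose]]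
  linear_diff[OF bounded_linear.linear[OF bounded_linear_transpose]]
  linear_neg[OF bounded_linear.linear[OF bounded_linear_transpose]]
  transpose_scalar matrix_transpose_mul

lemmas matmul_simps = matmul.add_left matmul.add_right matmul.diff_left matmul.diff_right
  matmul.minus_left matmul.minus_right matmul.scaleR_left matmul.scaleR_right matrix_mul_assoc

lemma inner_Euc_eq_inner: "inner_Euc X Y = X \<bullet> Y"
  unfolding inner_Euc_def trace_def transpose_def matrix_matrix_mult_def inner_vec_def
  by (simp, rule sum.swap)

lemma transpose_inner_transpose: "transpose X \<bullet> transpose Y = X \<bullet> (Y :: real^'m^'n)"
  unfolding inner_vec_def transpose_def by (simp, rule sum.swap)

lemma matmul_inner_left: "(A ** X) \<bullet> Y = X \<bullet> (transpose A ** (Y :: real^'m^'n))"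
  by (simp add: inner_Euc_eq_inner[symmetric] inner_Euc_def matrix_transpose_mul matrix_mul_assoc)

lemma matmul_inner_right: "(X ** A) \<bullet> Y = X \<bullet> ((Y :: real^'m^'n) ** transpose A)"
proof -
  have "(X ** A) \<bullet> Y = (transpose A ** transpose X) \<bullet> transpose Y"
    by (simp add: transpose_inner_transpose flip: matrix_transpose_mul)
  also have "\<dots> = transpose X \<bullet> transpose (Y ** transpose A)"
    by (simp add: matmul_inner_left matrix_transpose_mul)
  finally show ?thesis by (simp only: transpose_inner_transpose)
qed

lemma transpose_J [simp]: "transpose J = - J"
  by (auto simp: vec_eq_iff transpose_def J_def split: sum.split)

lemma J_mult_J [simp]: "J ** J = - mat 1"
proof -
  have s: "(\<Sum>k\<in>UNIV. f k) = (\<Sum>k\<in>UNIV. f (Inl k)) + (\<Sum>k\<in>UNIV. f (Inr k))"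
    for f :: "'n::finite + 'n \<Rightarrow> real"
    by (subst UNIV_sum, subst sum.union_disjoint) (auto simp: sum.reindex)
  show ?thesis
    by (simp add: vec_eq_iff matrix_mult_component s split_sum_all J_def mat_def
        if_distrib if_distribR cong: if_cong)
qed

lemma mult_J_J [simp]: "A ** J ** J = - A"
  by (simp add: matrix_mul_assoc[symmetric] matmul.minus_right)

lemma mult_J_J_mult [simp]: "A ** J ** (J ** B) = - (A ** B)" "J ** (J ** B) = - B"
  by (simp_all add: matrix_mul_assoc matmul.minus_left)

section \<open>The symplectic group and its Lie algebra\<close>

text \<open>The symplectic Lie algebra, usually given by X^T J + J X = 0. It is written as the fixed
  space of the linear involution A -> J A^T J, so that averaging over the involution projects onto
  it.\<close>

definition sp :: "'n::finite mat2n set" where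
  "sp = {X. J ** transpose X ** J = X}"

lemma subspace_sp: "subspace sp"
  by (auto simp: subspace_def sp_def transpose_simps matmul_simps)

lemma J_Sym_sp: "transpose S = S \<Longrightarrow> J ** S \<in> sp"
  by (simp add: sp_def transpose_simps matmul_simps)

lemma transpose_mult_J_sp:
  assumes "X \<in> sp" shows "transpose (transpose X ** J) = transpose X ** J"
proof -
  have "J ** (transpose X ** J) = X"
    using assms by (simp add: sp_def matrix_mul_assoc)
  then have "J ** (J ** (transpose X ** J)) = J ** X" by simp
  then have "transpose X ** J = - (J ** X)" by (simp add: minus_equation_iff)
  then show ?thesis by (simp add: transpose_simps matmul.minus_left matmul.minus_right)
qed

lemma sp_iff: "X \<in> sp \<longleftrightarrow> (\<exists>S\<in>Sym. X = J ** S)"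
proof
  assume X: "X \<in> sp"
  then show "\<exists>S\<in>Sym. X = J ** S"
    using transpose_mult_J_sp[OF X]
    by (intro bexI[of _ "transpose X ** J"]) (auto simp: Sym_def sp_def matrix_mul_assoc)
qed (auto simp: Sym_def J_Sym_sp)

lemma T_Sp_eq: "T_Sp M = (\<lambda>X. M ** X) ` sp"
proof
  show "T_Sp M \<subseteq> (\<lambda>X. M ** X) ` sp"
    by (auto simp: T_Sp_def Sym_def matrix_mul_assoc[symmetric] intro!: imageI J_Sym_sp)
  show "(\<lambda>X. M ** X) ` sp \<subseteq> T_Sp M"
    by (auto simp: T_Sp_def sp_iff matrix_mul_assoc) blast
qed

lemma transpose_sp:
  assumes "X \<in> sp" shows "transpose X = J ** X ** J" "transpose X \<in> sp"
proof -
  show e: "transpose X = J ** X ** J"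
    by (subst (2) assms[unfolded sp_def, simplified, symmetric]) (simp add: matmul_simps)
  show "transpose X \<in> sp" by (simp add: sp_def e[symmetric])
qed

text \<open>The involution A -> J A^T J sends A B to - (B A) for A and B in \<open>sp\<close>, hence
  fixes A B - B A.\<close>

lemma commutator_sp:
  assumes "X \<in> sp" "Y \<in> sp" shows "commutator X Y \<in> sp"
proof -
  have "J ** transpose (A ** B) ** J = - (B ** A)" if "A \<in> sp" "B \<in> sp" for A B :: "'a mat2n"
  proof -
    have "B ** A = (J ** transpose B ** J) ** (J ** transpose A ** J)"
      using that by (simp add: sp_def)
    then show ?thesis by (simp add: transpose_simps matmul_simps)
  qed
  then show ?thesis
    using assms by (simp add: sp_def commutator_def transpose_simps matmul_simps)
qed

text \<open>On \<open>Sp\<close> the inverse is a linear function of the matrix.\<close>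

definition sp_inv :: "'n::finite mat2n \<Rightarrow> 'n mat2n" where
  "sp_inv N = - (J ** transpose N ** J)"

lemma bounded_linear_sp_inv: "bounded_linear sp_inv"
  unfolding sp_inv_def
  by (intro bounded_linear_minus bounded_linear_compose[OF matmul.bounded_linear_left]
      bounded_linear_compose[OF matmul.bounded_linear_right] bounded_linear_transpose)

lemma sp_inv_left: "N \<in> Sp \<Longrightarrow> sp_inv N ** N = mat 1"
proof -
  assume "N \<in> Sp"
  then have "J ** (transpose N ** J ** N) = J ** J" by (simp add: Sp_def)
  then show ?thesis by (simp add: sp_inv_def matmul_simps)
qed

lemma sp_inv_right: "N \<in> Sp \<Longrightarrow> N ** sp_inv N = mat 1"
  using sp_inv_left matrix_left_right_inverse by blast

lemma Sp_subset_Gl: "Sp \<subseteq> Gl"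
  using sp_inv_left sp_inv_right by (fastforce simp: Gl_def invertible_def)

lemma sp_inv_cancel: "N \<in> Sp \<Longrightarrow> sp_inv N ** (N ** A) = A" "N \<in> Sp \<Longrightarrow> N ** (sp_inv N ** A) = A"
  by (simp_all add: matrix_mul_assoc sp_inv_left sp_inv_right)

lemma T_SpD: "N \<in> Sp \<Longrightarrow> X \<in> T_Sp N \<Longrightarrow> sp_inv N ** X \<in> sp"
  by (auto simp: T_Sp_eq sp_inv_cancel)

lemma matrix_inv_Sp: "N \<in> Sp \<Longrightarrow> matrix_inv N = sp_inv N"
proof -
  assume N: "N \<in> Sp"
  then have "matrix_inv N ** N = mat 1"
    using sp_inv_left sp_inv_right unfolding matrix_inv_def by (metis (mono_tags, lifting) someI)
  then have "matrix_inv N ** (N ** sp_inv N) = sp_inv N" by (simp add: matrix_mul_assoc)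
  then show ?thesis by (simp add: sp_inv_right[OF N])
qed

lemma inner_Inv_Sp: "N \<in> Sp \<Longrightarrow> inner_Inv N X Y = (sp_inv N ** X) \<bullet> (sp_inv N ** Y)"
  by (simp add: inner_Inv_def matrix_inv_Sp inner_Euc_eq_inner[symmetric] inner_Euc_def
      transpose_simps matrix_mul_assoc)

section \<open>Uniqueness of derivatives along \<open>Sp\<close> on tangent vectors\<close>

text \<open>Polarisation: with \<open>R u\<close> for u u^T, \<open>R\<close> at a sum of two axis
  vectors minus \<open>R\<close> at each of them is the symmetrised matrix unit. These span the
  symmetric matrices.\<close>

lemma Sym_rank_one_induct:
  fixes P :: "(real^'k^'k) set"
  assumes "subspace P" "\<And>u. (\<chi> i j. u$i * u$j) \<in> P" "transpose S = S"
  shows "S \<in> P"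
proof -
  define R where "R u = (\<chi> i j. u$i * u$j)" for u :: "real^'k"
  have "S$l$k = S$k$l" for k l
    using assms(3) by (metis transpose_def vec_lambda_beta)
  moreover have "(R (axis i 1 + axis j 1) - R (axis i 1) - R (axis j 1))$k$l =
      axis i 1 $ k * axis j 1 $ l + axis j 1 $ k * axis i 1 $ l" for i j k l
    by (simp add: R_def algebra_simps)
  moreover have "(\<Sum>i\<in>UNIV. \<Sum>j\<in>UNIV. S$i$j * (axis i 1 $ k * axis j 1 $ l)) = S$k$l"
    "(\<Sum>i\<in>UNIV. \<Sum>j\<in>UNIV. S$i$j * (axis j 1 $ k * axis i 1 $ l)) = S$l$k" for k l
    by (simp_all add: axis_def if_distrib[of "\<lambda>x. _ * x"] if_distribR cong: if_cong)
      (subst sum.swap, simp)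
  \<comment> \<open>The sum over all ordered pairs yields S + S^T, hence the factor 1/2.\<close>
  ultimately have "S = (1/2) *\<^sub>R (\<Sum>i\<in>UNIV. \<Sum>j\<in>UNIV.
      S$i$j *\<^sub>R (R (axis i 1 + axis j 1) - R (axis i 1) - R (axis j 1)))"
    by (simp add: vec_eq_iff ring_distribs sum.distrib)
  also have "\<dots> \<in> P"
    using assms(2)[folded R_def] by (intro subspace_scale subspace_sum subspace_diff assms(1))
  finally show ?thesis .
qed

text \<open>The lines \<open>M + t M J u u\<^sup>T\<close> stay inside \<open>Sp\<close>, and their directions span the tangent space.\<close>

lemma Sp_line:
  assumes "M \<in> Sp"
  shows "M + t *\<^sub>R (M ** J ** (\<chi> i j. u$i * u$j)) \<in> Sp"
proof -
  define R where "R = (\<chi> i j. u$i * u$j)"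
  have tR: "transpose R = R" by (simp add: R_def transpose_def mult.commute)
  \<comment> \<open>This is u^T J u, which vanishes because \<open>J\<close> is antisymmetric. It is
    a factor of R J R, the coefficient of t^2; the terms of first order in t cancel by
    themselves.\<close>
  define q where "q = (\<Sum>k\<in>UNIV. \<Sum>l\<in>UNIV. u$k * J$k$l * u$l)"
  have "q = (\<Sum>l\<in>UNIV. \<Sum>k\<in>UNIV. u$k * transpose J$l$k * u$l)"
    unfolding q_def by (subst sum.swap) (simp add: transpose_def)
  also have "\<dots> = - q" by (simp add: q_def sum_negf[symmetric] mult_ac)
  finally have "q = 0" by simp
  moreover have "(R ** J ** R)$i$j = u$i * u$j * q" for i j
    unfolding q_def
    by (simp add: matrix_mult_component R_def sum_distrib_left sum_distrib_right mult_ac)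
      (subst sum.swap, simp add: mult_ac)
  ultimately have RJR: "R ** J ** R = 0" by (simp add: vec_eq_iff)
  have M: "transpose M ** J ** M = J" using assms by (simp add: Sp_def)
  have M': "A ** transpose M ** J ** M = A ** J" for A
  proof -
    have "A ** (transpose M ** J ** M) = A ** J" by (simp add: M)
    then show ?thesis by (simp add: matrix_mul_assoc)
  qed
  have "transpose (M + t *\<^sub>R (M ** J ** R)) ** J ** (M + t *\<^sub>R (M ** J ** R)) = J"
    by (simp add: transpose_simps matmul_simps tR M M' RJR)
  then show ?thesis by (simp add: Sp_def R_def)
qed

text \<open>Derivatives relative to the thin set \<open>Sp\<close> are not unique as linear maps.
  Restricted to a line inside \<open>Sp\<close> they are derivatives in one real variable, which are
  unique, and the directions of these lines span \<open>T_Sp M\<close>. This allows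
  \<open>dir_deriv\<close> to be computed from any available derivative.\<close>

lemma Sp_derivative_unique:
  fixes M :: "'a::finite mat2n"
  assumes "M \<in> Sp" "(f has_derivative f') (at M within Sp)"
    "(f has_derivative f'') (at M within Sp)" "v \<in> T_Sp M"
  shows "f' v = f'' v"
proof -
  have l: "linear f'" "linear f''"
    using assms(2,3) by (auto intro: has_derivative_linear)
  have "S \<in> {S. f' (M ** J ** S) = f'' (M ** J ** S)}" if S: "transpose S = S" for S
  proof (rule Sym_rank_one_induct[OF _ _ S])
    show "subspace {S. f' (M ** J ** S) = f'' (M ** J ** S)}"
      by (auto simp: subspace_def matmul.add_right matmul.scaleR_right l[THEN linear_add]
          l[THEN linear_scale] l[THEN linear_0])
    fix u :: "real^('a + 'a)"
    define X where "X = M ** J ** (\<chi> i j. u$i * u$j)"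
    have line: "((\<lambda>t. f (M + t *\<^sub>R X)) has_derivative (\<lambda>t. F (t *\<^sub>R X))) (at 0)"
      if "(f has_derivative F) (at M within Sp)" for F
    proof (rule has_derivative_in_compose[of "\<lambda>t. M + t *\<^sub>R X" "\<lambda>t. t *\<^sub>R X"])
      show "((\<lambda>t. M + t *\<^sub>R X) has_derivative (\<lambda>t. t *\<^sub>R X)) (at 0)"
        by (auto intro!: derivative_eq_intros)
      show "(f has_derivative F) (at (M + 0 *\<^sub>R X) within range (\<lambda>t. M + t *\<^sub>R X))"
        using that Sp_line[OF assms(1)]
        by (auto intro!: has_derivative_subset[of f F M Sp] simp: X_def)
    qed
    have "(\<lambda>t. f' (t *\<^sub>R X)) = (\<lambda>t. f'' (t *\<^sub>R X))"
      by (rule has_derivative_unique[OF line line]) (fact assms)+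
    then have "f' (1 *\<^sub>R X) = f'' (1 *\<^sub>R X)" by (rule fun_cong)
    then show "(\<chi> i j. u$i * u$j) \<in> {S. f' (M ** J ** S) = f'' (M ** J ** S)}"
      by (simp add: X_def)
  qed
  then show ?thesis using assms(4) by (auto simp: T_Sp_def Sym_def)
qed

lemma dir_deriv_Sp:
  assumes "M \<in> Sp" "(f has_derivative f') (at M within Sp)" "v \<in> T_Sp M"
  shows "dir_deriv Sp f M v = f' v"
proof -
  have "f differentiable (at M within Sp)" using assms(2) by (rule differentiableI)
  then have "(f has_derivative frechet_derivative f (at M within Sp)) (at M within Sp)"
    by (simp add: frechet_derivative_works)
  from Sp_derivative_unique[OF assms(1) this assms(2,3)] show ?thesis
    by (simp add: dir_deriv_def)
qed

lemma has_derivative_dir_deriv: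
  assumes "smooth_on S f" "x \<in> S"
  shows "(f has_derivative dir_deriv S f x) (at x within S)"
  using smooth_on_differentiable[OF assms]
  by (simp add: frechet_derivative_works dir_deriv_def[abs_def])

text \<open>Tangency of \<open>X\<close> lets the relative derivative of \<open>f\<close> be
  replaced by that of an extension \<open>h\<close>. Applying the latter to an extension of
  \<open>X\<close> gives a smooth function on an open set.\<close>

lemma smooth_on_dir_deriv_Sp:
  assumes "smooth_on Sp f" "smooth_on Sp X" "\<And>x. x \<in> Sp \<Longrightarrow> X x \<in> T_Sp x"
  shows "smooth_on Sp (\<lambda>x. dir_deriv Sp f x (X x))"
  unfolding smooth_on_def
proof
  fix x :: "'a mat2n" assume "x \<in> Sp"
  with assms(1,2) obtain U h V k where h: "open U" "x \<in> U" "\<forall>n. Ck_on n U h" "\<forall>y\<in>Sp \<inter> U. h y = f y"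
    "open V" "x \<in> V" "\<forall>n. Ck_on n V k" "\<forall>y\<in>Sp \<inter> V. k y = X y"
    unfolding smooth_on_def by metis
  have "dir_deriv Sp f y (X y) = frechet_derivative h (at y) (k y)" if y: "y \<in> Sp \<inter> (U \<inter> V)" for y
  proof -
    have "h differentiable (at y)" using h(3)[rule_format, of "Suc 0"] y by auto
    from dir_deriv_Sp[OF _ extension_has_derivative[OF h(1) _ _ this h(4)] assms(3)] y h(8)
    show ?thesis by simp
  qed
  moreover have "Ck_on n (U \<inter> V) (\<lambda>y. frechet_derivative h (at y) (k y))" for n
    by (intro Ck_on_frechet_derivative open_Int h Ck_on_mono[OF h(3)[rule_format], of "U \<inter> V"]
        Ck_on_mono[OF h(7)[rule_format], of "U \<inter> V"]) auto
  ultimately show "\<exists>W l. open W \<and> x \<in> W \<and> (\<forall>n. Ck_on n W l) \<and>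
      (\<forall>y\<in>Sp \<inter> W. l y = dir_deriv Sp f y (X y))"
    using h(1,2,5,6)
    by (intro exI[of _ "U \<inter> V"] exI[of _ "\<lambda>y. frechet_derivative h (at y) (k y)"])
      (simp add: open_Int)
qed

section \<open>The Levi-Civita connection of the left invariant metric\<close>

text \<open>For the Frobenius product, the adjoint of bracketing with A is bracketing with
  A^T.\<close>

lemma commutator_inner: "commutator (transpose A) B \<bullet> C = B \<bullet> commutator A C"
  "commutator A B \<bullet> C = B \<bullet> commutator (transpose A) C"
  by (simp_all add: commutator_def inner_diff_left inner_diff_right matmul_inner_left[of _ B]
      matmul_inner_right[of B])

lemma commutator_skew: "commutator A B = - commutator B A"
  by (simp add: commutator_def)

text \<open>The Koszul formula for left invariant fields \<open>N A\<close>, \<open>N B\<close>, whose inner products are constant.\<close>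

definition lie_conn :: "'n::finite mat2n \<Rightarrow> 'n mat2n \<Rightarrow> 'n mat2n" where
  "lie_conn A B = (1/2) *\<^sub>R (commutator A B - commutator (transpose B) A - commutator (transpose A) B)"

lemma bounded_bilinear_lie_conn: "bounded_bilinear lie_conn"
  unfolding bilinear_conv_bounded_bilinear[symmetric] bilinear_def linear_iff
  by (simp add: lie_conn_def commutator_def transpose_simps matmul_simps algebra_simps)

lemma lie_conn_sp: "A \<in> sp \<Longrightarrow> B \<in> sp \<Longrightarrow> lie_conn A B \<in> sp"
  unfolding lie_conn_def
  by (intro subspace_scale subspace_diff subspace_sp commutator_sp transpose_sp)

text \<open>The two summands with transposes are exchanged when A and B are, so only the
  antisymmetric first summand survives.\<close>

lemma lie_conn_torsion: "lie_conn A B - lie_conn B A = commutator A B"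
proof -
  have "commutator A B + commutator A B = 2 *\<^sub>R commutator A B" by (simp add: scaleR_2)
  then show ?thesis
    using commutator_skew[of B A] by (simp add: lie_conn_def scaleR_diff_right[symmetric])
qed

text \<open>By the adjoint rule, twice the inner product of \<open>lie_conn A B\<close> with C is
  <[A,B],C> - <A,[B,C]> - <B,[A,C]>, which changes sign when B and C are swapped.\<close>

lemma lie_conn_metric: "lie_conn A B \<bullet> C + B \<bullet> lie_conn A C = 0"
  using commutator_inner[of B A C] commutator_inner[of C A B] commutator_inner[of A B C]
    commutator_skew[of B C]
  by (simp add: lie_conn_def inner_diff_left inner_diff_right inner_commute[of B])
    (simp add: field_simps)

definition Sp_conn :: "'n::finite mat2n \<Rightarrow> 'n mat2n \<Rightarrow> ('n mat2n \<Rightarrow> 'n mat2n) \<Rightarrow> 'n mat2n" where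
  "Sp_conn M V Y = M ** (dir_deriv Sp (\<lambda>N. sp_inv N ** Y N) M V
     + lie_conn (sp_inv M ** V) (sp_inv M ** Y M))"

lemma smooth_on_sp_inv_mult:
  "smooth_on Sp Y \<Longrightarrow> smooth_on Sp (\<lambda>N. sp_inv N ** Y N)"
  by (intro smooth_on_bilinear[OF bounded_bilinear_matrix_mult] smooth_on_ident
      smooth_on_linear[OF bounded_linear_sp_inv])

lemma vector_fieldsD:
  assumes "Y \<in> vector_fields Sp T_Sp"
  shows "smooth_on Sp Y" "N \<in> Sp \<Longrightarrow> Y N \<in> T_Sp N" "smooth_on Sp (\<lambda>N. sp_inv N ** Y N)"
    "N \<in> Sp \<Longrightarrow> sp_inv N ** Y N \<in> sp"
  using assms by (auto simp: vector_fields_def intro: smooth_on_sp_inv_mult T_SpD)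

text \<open>\<open>sp\<close> is the kernel of a linear map. Composing this map with
  \<open>y\<close> gives zero along \<open>Sp\<close>, so the derivative of \<open>y\<close> lies in
  the kernel as well.\<close>

lemma dir_deriv_sp:
  fixes M :: "'n::finite mat2n" and y :: "'n mat2n \<Rightarrow> 'n mat2n"
  assumes "smooth_on Sp y" "\<And>N. N \<in> Sp \<Longrightarrow> y N \<in> sp" "M \<in> Sp" "v \<in> T_Sp M"
  shows "dir_deriv Sp y M v \<in> sp"
proof -
  have l: "bounded_linear (\<lambda>A :: 'n mat2n. J ** transpose A ** J - A)"
    by (intro bounded_linear_sub bounded_linear_compose[OF matmul.bounded_linear_left]
        bounded_linear_compose[OF matmul.bounded_linear_right] bounded_linear_transpose
        bounded_linear_ident)
  have "((\<lambda>N. 0) has_derivative (\<lambda>v. J ** transpose (dir_deriv Sp y M v) ** J - dir_deriv Sp y M v))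
      (at M within Sp)"
    by (rule has_derivative_transform[OF assms(3) _ bounded_linear.has_derivative[OF l
            has_derivative_dir_deriv[OF assms(1,3)]]]) (use assms(2) in \<open>simp add: sp_def\<close>)
  from Sp_derivative_unique[OF assms(3) this has_derivative_const assms(4)]
  show ?thesis by (simp add: sp_def)
qed

lemma Sp_conn_is_connection: "is_connection (Sp :: 'n::finite mat2n set) T_Sp Sp_conn"
  unfolding is_connection_def
proof (intro conjI ballI allI impI)
  fix X Y :: "'n mat2n \<Rightarrow> 'n mat2n"
  assume X: "X \<in> vector_fields Sp T_Sp" and Y: "Y \<in> vector_fields Sp T_Sp"
  have "smooth_on Sp (\<lambda>x. Sp_conn x (X x) Y)"
    unfolding Sp_conn_def
    by (intro smooth_on_bilinear[OF bounded_bilinear_matrix_mult] smooth_on_ident smooth_on_add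
        smooth_on_dir_deriv_Sp smooth_on_bilinear[OF bounded_bilinear_lie_conn]
        vector_fieldsD[OF X] vector_fieldsD[OF Y])
  moreover have "Sp_conn x (X x) Y \<in> T_Sp x" if "x \<in> Sp" for x
    unfolding Sp_conn_def T_Sp_eq
    by (intro imageI subspace_add subspace_sp dir_deriv_sp lie_conn_sp
        vector_fieldsD[OF X] vector_fieldsD[OF Y] that)
  ultimately show "(\<lambda>x. Sp_conn x (X x) Y) \<in> vector_fields Sp T_Sp"
    by (simp add: vector_fields_def)
next
  fix M v w :: "'n mat2n" and a b :: real and Y :: "'n mat2n \<Rightarrow> 'n mat2n"
  assume M: "M \<in> Sp" and Y: "Y \<in> vector_fields Sp T_Sp"
  have "linear (dir_deriv Sp (\<lambda>N. sp_inv N ** Y N) M)"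
    by (rule has_derivative_linear[OF has_derivative_dir_deriv[OF vector_fieldsD(3)[OF Y] M]])
  then show "Sp_conn M (a *\<^sub>R v + b *\<^sub>R w) Y = a *\<^sub>R Sp_conn M v Y + b *\<^sub>R Sp_conn M w Y"
    by (simp add: Sp_conn_def linear_iff matmul.add_right matmul.scaleR_right
        bounded_bilinear.add_left[OF bounded_bilinear_lie_conn]
        bounded_bilinear.scaleR_left[OF bounded_bilinear_lie_conn] algebra_simps)
next
  fix M v :: "'n mat2n" and Y Z :: "'n mat2n \<Rightarrow> 'n mat2n"
  assume M: "M \<in> Sp" and v: "v \<in> T_Sp M"
    and Y: "Y \<in> vector_fields Sp T_Sp" and Z: "Z \<in> vector_fields Sp T_Sp"
  from dir_deriv_Sp[OF M has_derivative_add[OF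
        has_derivative_dir_deriv[OF vector_fieldsD(3)[OF Y] M]
        has_derivative_dir_deriv[OF vector_fieldsD(3)[OF Z] M]] v]
  show "Sp_conn M v (\<lambda>y. Y y + Z y) = Sp_conn M v Y + Sp_conn M v Z"
    by (simp add: Sp_conn_def matmul.add_right
        bounded_bilinear.add_right[OF bounded_bilinear_lie_conn])
next
  fix M v :: "'n mat2n" and f :: "'n mat2n \<Rightarrow> real" and Y :: "'n mat2n \<Rightarrow> 'n mat2n"
  assume M: "M \<in> Sp" and v: "v \<in> T_Sp M"
    and Y: "Y \<in> vector_fields Sp T_Sp" and f: "smooth_on Sp f"
  from dir_deriv_Sp[OF M has_derivative_scaleR[OF has_derivative_dir_deriv[OF f M]
        has_derivative_dir_deriv[OF vector_fieldsD(3)[OF Y] M]] v]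
  show "Sp_conn M v (\<lambda>y. f y *\<^sub>R Y y) = dir_deriv Sp f M v *\<^sub>R Y M + f M *\<^sub>R Sp_conn M v Y"
    by (simp add: Sp_conn_def matmul.scaleR_right matmul.add_right sp_inv_cancel[OF M]
        bounded_bilinear.scaleR_right[OF bounded_bilinear_lie_conn] algebra_simps)
qed

text \<open>Product rule for Y N = N (N^-1 Y N), comparing the ambient derivative with the left
  trivialised one.\<close>

lemma dir_deriv_vector_field:
  assumes M: "M \<in> Sp" and v: "v \<in> T_Sp M" and Y: "Y \<in> vector_fields Sp T_Sp"
  shows "dir_deriv Sp Y M v =
    M ** dir_deriv Sp (\<lambda>N. sp_inv N ** Y N) M v + v ** (sp_inv M ** Y M)"
  by (rule dir_deriv_Sp[OF M has_derivative_transform[OF M _ matmul.FDERIV[OF has_derivative_ident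
      has_derivative_dir_deriv[OF vector_fieldsD(3)[OF Y] M]]] v])
    (simp add: sp_inv_cancel)

lemma Sp_conn_is_levi_civita: "is_levi_civita (Sp :: 'n::finite mat2n set) T_Sp inner_Inv Sp_conn"
  unfolding is_levi_civita_def
proof (intro conjI ballI Sp_conn_is_connection)
  fix M :: "'n mat2n" and X Y :: "'n mat2n \<Rightarrow> 'n mat2n"
  assume M: "M \<in> Sp" and X: "X \<in> vector_fields Sp T_Sp" and Y: "Y \<in> vector_fields Sp T_Sp"
  define a b where "a = sp_inv M ** X M" and "b = sp_inv M ** Y M"
  have XY: "X M = M ** a" "Y M = M ** b" by (simp_all add: a_def b_def sp_inv_cancel[OF M])
  \<comment> \<open>Besides derivatives of the trivialised fields, the product rule puts
    \<open>X M ** b - Y M ** a\<close> into the Lie bracket. The torsion of \<open>lie_conn\<close>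
    supplies exactly this.\<close>
  have "M ** lie_conn a b - M ** lie_conn b a = M ** commutator a b"
    by (simp add: lie_conn_torsion flip: matmul.diff_right)
  moreover have "M ** commutator a b = X M ** b - Y M ** a"
    by (simp add: XY commutator_def matmul.diff_right matrix_mul_assoc)
  ultimately show "Sp_conn M (X M) Y - Sp_conn M (Y M) X = lie_bracket Sp X Y M"
    by (simp add: Sp_conn_def lie_bracket_def matmul.add_right algebra_simps
        dir_deriv_vector_field[OF M vector_fieldsD(2)[OF Y M] X]
        dir_deriv_vector_field[OF M vector_fieldsD(2)[OF X M] Y] flip: a_def b_def)
next
  fix M v :: "'n mat2n" and Y Z :: "'n mat2n \<Rightarrow> 'n mat2n"
  assume M: "M \<in> Sp" and v: "v \<in> T_Sp M"
    and Y: "Y \<in> vector_fields Sp T_Sp" and Z: "Z \<in> vector_fields Sp T_Sp"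
  \<comment> \<open>In left trivialisation the metric is the fixed Frobenius product, so the
    ordinary product rule suffices; the terms with \<open>lie_conn\<close> then cancel.\<close>
  have "dir_deriv Sp (\<lambda>y. inner_Inv y (Y y) (Z y)) M v =
      (sp_inv M ** Y M) \<bullet> dir_deriv Sp (\<lambda>N. sp_inv N ** Z N) M v +
      dir_deriv Sp (\<lambda>N. sp_inv N ** Y N) M v \<bullet> (sp_inv M ** Z M)"
    by (rule dir_deriv_Sp[OF M has_derivative_transform[OF M _ has_derivative_inner[OF
        has_derivative_dir_deriv[OF vector_fieldsD(3)[OF Y] M]
        has_derivative_dir_deriv[OF vector_fieldsD(3)[OF Z] M]]] v])
      (simp add: inner_Inv_Sp)
  then show "dir_deriv Sp (\<lambda>y. inner_Inv y (Y y) (Z y)) M v =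
      inner_Inv M (Sp_conn M v Y) (Z M) + inner_Inv M (Y M) (Sp_conn M v Z)"
    using lie_conn_metric[of "sp_inv M ** v" "sp_inv M ** Y M" "sp_inv M ** Z M"]
    by (simp add: inner_Inv_Sp[OF M] Sp_conn_def sp_inv_cancel[OF M] inner_add_left inner_add_right)
qed

section \<open>The chosen connection on left invariant fields\<close>

lemma is_levi_civitaD:
  assumes "is_levi_civita S T g D" "x \<in> S" "Y \<in> vector_fields S T" "Z \<in> vector_fields S T"
  shows "D x (Y x) Z - D x (Z x) Y = lie_bracket S Y Z x"
    and "v \<in> T x \<Longrightarrow>
      dir_deriv S (\<lambda>y. g y (Y y) (Z y)) x v = g x (D x v Y) (Z x) + g x (Y x) (D x v Z)"
  using assms unfolding is_levi_civita_def by blast+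

text \<open>\<open>levi_civita\<close> is a choice, so existence has to be secured:
  \<open>Sp_conn\<close> is the witness. From here on the chosen connection is used through its
  axioms.\<close>

lemma levi_civita_Sp: "is_levi_civita Sp T_Sp inner_Inv (levi_civita Sp T_Sp inner_Inv)"
  unfolding levi_civita_def by (rule someI[of _ Sp_conn]) (rule Sp_conn_is_levi_civita)

lemma left_invariant_vector_field: "A \<in> sp \<Longrightarrow> (\<lambda>N. N ** A) \<in> vector_fields Sp T_Sp"
  by (auto simp: vector_fields_def T_Sp_eq intro: smooth_on_linear[OF matmul.bounded_linear_left]
      smooth_on_ident)

text \<open>The uniqueness argument behind the Koszul formula, applied to the difference of two
  metric and torsion-free connections: the two symmetries permute the arguments of \<open>D\<close>, and
  \<open>D a b c\<close> returns to itself with the opposite sign.\<close>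

lemma Koszul_unique:
  fixes D :: "'a \<Rightarrow> 'a \<Rightarrow> 'a \<Rightarrow> real"
  assumes "\<And>a b c. \<lbrakk>a \<in> V; b \<in> V; c \<in> V\<rbrakk> \<Longrightarrow> D a b c + D a c b = 0"
    and "\<And>a b c. \<lbrakk>a \<in> V; b \<in> V; c \<in> V\<rbrakk> \<Longrightarrow> D a b c = D b a c"
    and "a \<in> V" "b \<in> V" "c \<in> V"
  shows "D a b c = 0"
  using assms(1)[of a b c] assms(1)[of b a c] assms(1)[of c a b]
    assms(2)[of a b c] assms(2)[of a c b] assms(2)[of b c a] assms(3-5)
  by simp

lemma levi_civita_left_invariant:
  assumes M: "M \<in> Sp" and "A \<in> sp" "B \<in> sp" "C \<in> sp"
  shows "inner_Inv M (levi_civita Sp T_Sp inner_Inv M (M ** A) (\<lambda>N. N ** B)) (M ** C) =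
    lie_conn A B \<bullet> C"
proof -
  define \<Gamma> where "\<Gamma> A B = levi_civita Sp T_Sp inner_Inv M (M ** A) (\<lambda>N. N ** B)" for A B
  note L = left_invariant_vector_field
  have T: "M ** A \<in> T_Sp M" if "A \<in> sp" for A using that by (simp add: T_Sp_eq)
  have metric: "inner_Inv M (\<Gamma> A B) (M ** C) + inner_Inv M (\<Gamma> A C) (M ** B) = 0"
    if "A \<in> sp" "B \<in> sp" "C \<in> sp" for A B C
  proof -
    have "dir_deriv Sp (\<lambda>N. inner_Inv N (N ** B) (N ** C)) M (M ** A) = 0"
      by (rule dir_deriv_Sp[OF M has_derivative_transform[OF M _ has_derivative_const[of "B \<bullet> C"]] T])
        (simp_all add: inner_Inv_Sp sp_inv_cancel that)
    moreover have "dir_deriv Sp (\<lambda>N. inner_Inv N (N ** B) (N ** C)) M (M ** A) =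
        inner_Inv M (\<Gamma> A B) (M ** C) + inner_Inv M (M ** B) (\<Gamma> A C)"
      unfolding \<Gamma>_def
      by (rule is_levi_civitaD(2)[OF levi_civita_Sp M L[OF that(2)] L[OF that(3)] T[OF that(1)]])
    ultimately show ?thesis by (simp add: inner_Inv_Sp[OF M] inner_commute)
  qed
  have torsion: "\<Gamma> A B - \<Gamma> B A = M ** commutator A B" if "A \<in> sp" "B \<in> sp" for A B
  proof -
    have d: "dir_deriv Sp (\<lambda>N. N ** B) M v = v ** B" if "v \<in> T_Sp M" for v B
      by (rule dir_deriv_Sp[OF M bounded_linear_imp_has_derivative[OF matmul.bounded_linear_left] that])
    have "\<Gamma> A B - \<Gamma> B A = lie_bracket Sp (\<lambda>N. N ** A) (\<lambda>N. N ** B) M"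
      unfolding \<Gamma>_def
      by (rule is_levi_civitaD(1)[OF levi_civita_Sp M L[OF that(1)] L[OF that(2)]])
    then show ?thesis
      by (simp add: lie_bracket_def d T that commutator_def matmul.diff_right matrix_mul_assoc)
  qed
  have "inner_Inv M (\<Gamma> A B) (M ** C) - lie_conn A B \<bullet> C = 0"
  \<comment> \<open>Both connections have the same torsion and metric rules, so their difference is
    skew in the last two arguments and symmetric in the first two.\<close>
  proof (rule Koszul_unique[of sp "\<lambda>A B C. inner_Inv M (\<Gamma> A B) (M ** C) - lie_conn A B \<bullet> C"])
    fix A B C :: "'a mat2n"
    assume ABC: "A \<in> sp" "B \<in> sp" "C \<in> sp"
    show "inner_Inv M (\<Gamma> A B) (M ** C) - lie_conn A B \<bullet> C +
        (inner_Inv M (\<Gamma> A C) (M ** B) - lie_conn A C \<bullet> B) = 0"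
      using metric[OF ABC] lie_conn_metric[of A B C] by (simp add: inner_commute)
    have "(sp_inv M ** (\<Gamma> A B - \<Gamma> B A)) \<bullet> C = (lie_conn A B - lie_conn B A) \<bullet> C"
      by (simp add: torsion ABC sp_inv_cancel[OF M] lie_conn_torsion)
    then show "inner_Inv M (\<Gamma> A B) (M ** C) - lie_conn A B \<bullet> C =
        inner_Inv M (\<Gamma> B A) (M ** C) - lie_conn B A \<bullet> C"
      by (simp add: inner_Inv_Sp[OF M] sp_inv_cancel[OF M] matmul.diff_right inner_diff_left)
  qed (fact assms)+
  then show ?thesis by (simp add: \<Gamma>_def)
qed

section \<open>Gradients\<close>

text \<open>The Frobenius-orthogonal projection onto \<open>sp\<close>, obtained by averaging over
  the involution that defines \<open>sp\<close>.\<close>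

definition sp_proj :: "'n::finite mat2n \<Rightarrow> 'n mat2n" where
  "sp_proj A = (1/2) *\<^sub>R (A + J ** transpose A ** J)"

lemma sp_proj_sp: "sp_proj A \<in> sp"
  by (simp add: sp_proj_def sp_def transpose_simps matmul_simps add.commute)

lemma sp_proj_inner:
  assumes "C \<in> sp" shows "sp_proj A \<bullet> C = A \<bullet> C"
proof -
  have "(J ** transpose A ** J) \<bullet> C = transpose A \<bullet> (transpose J ** (C ** transpose J))"
    by (simp only: matmul_inner_right[of "J ** transpose A" J] matmul_inner_left[of J "transpose A"])
  also have "\<dots> = transpose A \<bullet> (J ** C ** J)"
    by (simp add: matmul_simps)
  also have "\<dots> = A \<bullet> C"
    by (simp add: transpose_sp(1)[OF assms, symmetric] transpose_inner_transpose)
  finally show ?thesis by (simp add: sp_proj_def inner_add_left)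
qed

lemma bounded_linear_sp_proj: "bounded_linear sp_proj"
  unfolding linear_conv_bounded_linear[symmetric] linear_iff
  by (simp add: sp_proj_def transpose_simps matmul_simps algebra_simps)

text \<open>In left trivialisation the gradient is the element of \<open>sp\<close> representing the
  functional C -> <M^T A, C>, that is, the projection of M^T A.\<close>

lemma riem_grad_Sp:
  assumes M: "M \<in> Sp" and d: "(f has_derivative (\<lambda>V. A \<bullet> V)) (at M within Sp)"
  shows "riem_grad Sp T_Sp inner_Inv f M = M ** sp_proj (transpose M ** A)"
  unfolding riem_grad_def
proof (rule the_equality)
  have eq: "inner_Inv M (M ** B) (M ** C) = dir_deriv Sp f M (M ** C) \<longleftrightarrow>
      B \<bullet> C = sp_proj (transpose M ** A) \<bullet> C" if "C \<in> sp" for B C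
  proof -
    have "dir_deriv Sp f M (M ** C) = A \<bullet> (M ** C)"
      by (rule dir_deriv_Sp[OF M d]) (simp add: T_Sp_eq that)
    also have "\<dots> = sp_proj (transpose M ** A) \<bullet> C"
      by (simp add: sp_proj_inner[OF that] matmul_inner_left)
    finally show ?thesis by (simp add: inner_Inv_Sp[OF M] sp_inv_cancel[OF M])
  qed
  show "M ** sp_proj (transpose M ** A) \<in> T_Sp M \<and>
      (\<forall>w\<in>T_Sp M. inner_Inv M (M ** sp_proj (transpose M ** A)) w = dir_deriv Sp f M w)"
    by (auto simp: T_Sp_eq eq sp_proj_sp)
  fix u assume u: "u \<in> T_Sp M \<and> (\<forall>w\<in>T_Sp M. inner_Inv M u w = dir_deriv Sp f M w)"
  then obtain B where B: "u = M ** B" "B \<in> sp" by (auto simp: T_Sp_eq)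
  have "B \<bullet> C = sp_proj (transpose M ** A) \<bullet> C" if "C \<in> sp" for C
    using u that by (auto simp: T_Sp_eq B(1) eq)
  \<comment> \<open>The difference lies in \<open>sp\<close>, so it may itself serve as the test
    vector.\<close>
  then have "(B - sp_proj (transpose M ** A)) \<bullet> (B - sp_proj (transpose M ** A)) = 0"
    using subspace_diff[OF subspace_sp B(2) sp_proj_sp[of "transpose M ** A"]]
    by (simp add: inner_diff_left)
  then show "u = M ** sp_proj (transpose M ** A)" by (simp add: B(1))
qed

lemma open_Gl: "open (Gl :: 'n::finite mat2n set)"
proof -
  have "continuous_on UNIV (\<lambda>A :: 'n mat2n. det A)"
    unfolding det_def by (intro continuous_intros)
  moreover have "Gl = (\<lambda>A :: 'n mat2n. det A) -` (- {0})"
    by (auto simp: Gl_def invertible_det_nz)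
  ultimately show ?thesis by (metis open_vimage open_Compl closed_singleton)
qed

lemma has_derivative_grad_Euc:
  assumes "G differentiable (at N)"
  shows "(G has_derivative (\<lambda>V. grad_Euc G N \<bullet> V)) (at N)"
proof -
  have d: "(G has_derivative frechet_derivative G (at N)) (at N)"
    using assms by (simp add: frechet_derivative_works)
  define A where "A = (\<Sum>b\<in>Basis. frechet_derivative G (at N) b *\<^sub>R b)"
  have "frechet_derivative G (at N) = (\<lambda>V. A \<bullet> V)"
  proof
    fix V
    show "frechet_derivative G (at N) V = A \<bullet> V"
      using linear_basis_sum[OF has_derivative_linear[OF d], of V]
      by (simp add: A_def inner_sum_left inner_commute[of V] mult.commute)
  qed
  with d have dA: "(G has_derivative (\<lambda>V. inner_Euc A V)) (at N)"
    by (simp add: inner_Euc_eq_inner)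
  moreover have "B = A" if "(G has_derivative (\<lambda>V. inner_Euc B V)) (at N)" for B
  proof -
    have "(\<lambda>V. B \<bullet> V) = (\<lambda>V. A \<bullet> V)"
      using has_derivative_unique[OF that dA] by (simp add: inner_Euc_eq_inner)
    then have "(B - A) \<bullet> (B - A) = 0" by (simp add: inner_diff_left fun_eq_iff)
    then show ?thesis by simp
  qed
  ultimately have "grad_Euc G N = A" unfolding grad_Euc_def by (rule the_equality)
  with dA show ?thesis by (simp add: inner_Euc_eq_inner)
qed

lemma frechet_derivative_grad_Euc:
  "G differentiable (at N) \<Longrightarrow> frechet_derivative G (at N) V = grad_Euc G N \<bullet> V"
  using frechet_derivative_at[OF has_derivative_grad_Euc] by metis

lemma Ck_on_grad_Euc:
  assumes "open U" "Ck_on (Suc k) U G"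
  shows "Ck_on k U (grad_Euc G)"
proof (rule Ck_on_cong[OF assms(1)])
  show "Ck_on k U (\<lambda>N. \<Sum>b\<in>Basis. frechet_derivative G (at N) b *\<^sub>R b)"
    by (intro Ck_on_sum assms(1) Ck_on_linear[OF bounded_linear_scaleR_left])
      (use assms(2) in simp)
  fix N assume "N \<in> U"
  then have "G differentiable (at N)" using assms(2) by simp
  then show "(\<Sum>b\<in>Basis. frechet_derivative G (at N) b *\<^sub>R b) = grad_Euc G N"
    by (simp add: frechet_derivative_grad_Euc euclidean_representation)
qed

section \<open>The Hessian\<close>

lemma Hess_Inv_left_invariant:
  fixes Gt G :: "'n::finite mat2n \<Rightarrow> real"
  assumes G: "smooth_on Gl G" and eq: "\<And>N. N \<in> Sp \<Longrightarrow> G N = Gt N"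
    and M: "M \<in> Sp" and A: "A \<in> sp" and B: "B \<in> sp"
  shows "Hess_Inv Gt M (M ** A) (M ** B) =
    Hess_Euc G M (M ** A) (M ** B) + grad_Euc G M \<bullet> (M ** (A ** B - lie_conn A B))"
proof -
  let ?g = "riem_grad Sp T_Sp inner_Inv Gt"
  have Ck: "Ck_on k Gl G" for k by (rule smooth_on_imp_Ck_on[OF open_Gl G])
  have diff: "G differentiable (at N)" if "N \<in> Gl" for N
    using Ck[of "Suc 0"] that by simp
  have Ckg: "Ck_on k Gl (grad_Euc G)" for k by (rule Ck_on_grad_Euc[OF open_Gl Ck])
  have grad: "?g N = N ** sp_proj (transpose N ** grad_Euc G N)" if N: "N \<in> Sp" for N
    by (rule riem_grad_Sp[OF N has_derivative_transform[OF N _ has_derivative_at_withinI[OF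
        has_derivative_grad_Euc[OF diff]]]]) (use N Sp_subset_Gl eq in auto)
  \<comment> \<open>Metric compatibility is available for smooth tangent fields only, so the
    gradient must first be shown to be one; its closed form makes this visible.\<close>
  have smooth_g: "smooth_on Sp ?g"
    by (rule smooth_on_cong[OF _ grad[symmetric]])
      (intro smooth_on_bilinear[OF bounded_bilinear_matrix_mult] smooth_on_ident
        smooth_on_linear[OF bounded_linear_sp_proj] smooth_on_linear[OF bounded_linear_transpose]
        smooth_on_subset[OF Ck_on_imp_smooth_on[OF open_Gl Ckg] Sp_subset_Gl])
  then have vf: "?g \<in> vector_fields Sp T_Sp"
    by (auto simp: vector_fields_def grad T_Sp_eq sp_proj_sp)
  have inner_grad: "inner_Inv N (?g N) (N ** C) = grad_Euc G N \<bullet> (N ** C)"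
    if "N \<in> Sp" "C \<in> sp" for N C
    using that by (simp add: inner_Inv_Sp grad sp_inv_cancel sp_proj_inner matmul_inner_left[of N]
        inner_commute[of "transpose N ** grad_Euc G N"] inner_commute[of "grad_Euc G N"])
  define H where "H = frechet_derivative (grad_Euc G) (at M)"
  have MGl: "M \<in> Gl" using M Sp_subset_Gl by blast
  have H: "(grad_Euc G has_derivative H) (at M)"
    using Ckg[of "Suc 0"] MGl by (simp add: H_def frechet_derivative_works)
  have HE: "Hess_Euc G M U V = H U \<bullet> V" for U V
  proof -
    have "((\<lambda>N. frechet_derivative G (at N) V) has_derivative (\<lambda>U. H U \<bullet> V)) (at M)"
      by (rule has_derivative_transform_within_open[OF has_derivative_inner_left[OF H] open_Gl MGl])
        (simp add: frechet_derivative_grad_Euc diff)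
    from frechet_derivative_at[OF this] show ?thesis
      unfolding Hess_Euc_def by metis
  qed
  have T: "M ** A \<in> T_Sp M" using A by (simp add: T_Sp_eq)
  \<comment> \<open>Along \<open>Sp\<close> the differentiated function is the derivative of
    \<open>G\<close> along the field N B. Since that field moves with N, the term with M A B joins
    the Euclidean Hessian.\<close>
  have "dir_deriv Sp (\<lambda>N. inner_Inv N (?g N) (N ** B)) M (M ** A) =
      grad_Euc G M \<bullet> (M ** A ** B) + H (M ** A) \<bullet> (M ** B)"
    by (rule dir_deriv_Sp[OF M has_derivative_transform[OF M _ has_derivative_inner[OF
        has_derivative_at_withinI[OF H]
        bounded_linear_imp_has_derivative[OF matmul.bounded_linear_left]]] T])
      (simp add: inner_grad B)
  moreover have "dir_deriv Sp (\<lambda>N. inner_Inv N (?g N) (N ** B)) M (M ** A) =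
      inner_Inv M (levi_civita Sp T_Sp inner_Inv M (M ** A) ?g) (M ** B) +
      inner_Inv M (?g M) (levi_civita Sp T_Sp inner_Inv M (M ** A) (\<lambda>N. N ** B))"
    by (rule is_levi_civitaD(2)[OF levi_civita_Sp M vf left_invariant_vector_field[OF B] T])
  moreover have "inner_Inv M (?g M) (levi_civita Sp T_Sp inner_Inv M (M ** A) (\<lambda>N. N ** B)) =
      grad_Euc G M \<bullet> (M ** lie_conn A B)"
  proof -
    \<comment> \<open>The trivialised gradient is an admissible test vector in \<open>sp\<close>. As
      \<open>lie_conn A B\<close> is in \<open>sp\<close> too, the pairing turns back into a
      Euclidean one.\<close>
    have "inner_Inv M (levi_civita Sp T_Sp inner_Inv M (M ** A) (\<lambda>N. N ** B)) (?g M) =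
        lie_conn A B \<bullet> sp_proj (transpose M ** grad_Euc G M)"
      unfolding grad[OF M] by (rule levi_civita_left_invariant[OF M A B sp_proj_sp])
    also have "\<dots> = inner_Inv M (?g M) (M ** lie_conn A B)"
      by (simp add: inner_Inv_Sp[OF M] grad[OF M] sp_inv_cancel[OF M] inner_commute)
    also have "\<dots> = grad_Euc G M \<bullet> (M ** lie_conn A B)"
      by (rule inner_grad[OF M lie_conn_sp[OF A B]])
    finally show ?thesis by (simp add: inner_Inv_Sp[OF M] inner_commute)
  qed
  ultimately show ?thesis
    by (simp add: Hess_Inv_def riem_hess_def HE matmul.diff_right inner_diff_right matrix_mul_assoc)
qed

section \<open>Algebra of \<open>Z_term\<close> and of the antisymmetric matrix
  \<open>Gamma_tilde\<close>\<close>

text \<open>In the sum of \<open>Z_term A B\<close> and \<open>lie_conn A B\<close> the transposed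
  commutators cancel, and A B + B A + [A,B] = 2 A B.\<close>

lemma Z_term_eq: "Z_term A B = A ** B - lie_conn A B"
proof -
  have "Z_term A B + lie_conn A B = (1/2) *\<^sub>R (A ** B + A ** B)"
    unfolding Z_term_def lie_conn_def scaleR_add_right[symmetric]
    by (simp add: commutator_def[of A B])
  then show ?thesis by (simp add: eq_diff_eq)
qed

lemma antisym_inner_sp:
  assumes "transpose \<Gamma> = - \<Gamma>" "C \<in> sp"
  shows "\<Gamma> \<bullet> (J ** C) = 0"
proof -
  have "\<Gamma> \<bullet> (J ** C) = transpose \<Gamma> \<bullet> transpose (J ** C)" by (simp add: transpose_inner_transpose)
  also have "transpose (J ** C) = J ** C"
    by (simp add: transpose_simps transpose_sp(1)[OF assms(2)] matmul_simps)
  finally show ?thesis by (simp add: assms(1))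
qed

text \<open>Only the antisymmetry of \<open>\<Gamma>\<close> matters: \<open>J C\<close> is symmetric for \<open>C \<in> sp\<close>, so
  \<open>\<Gamma>\<close> does not see the summand \<open>lie_conn A B\<close> of \<open>Z_term A B\<close>.\<close>

lemma kron_form_eq_inner_Z_term:
  assumes "transpose \<Gamma> = - \<Gamma>" "M \<in> Sp" "A \<in> sp" "B \<in> sp"
  shows "kron_form \<Gamma> J (M ** A) (M ** B) = inner_Euc (J ** M ** \<Gamma>) (M ** Z_term A B)"
proof -
  have M: "transpose M ** J ** M = J" using assms(2) by (simp add: Sp_def)
  have "kron_form \<Gamma> J (M ** A) (M ** B) =
      trace (transpose A ** (transpose M ** J ** M) ** B ** transpose \<Gamma>)"
    by (simp add: kron_form_eq_trace transpose_simps matrix_mul_assoc)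
  also have "\<dots> = trace (transpose \<Gamma> ** (transpose A ** J ** B))"
    by (simp only: M trace_mul_sym[of _ "transpose \<Gamma>"])
  also have "transpose A ** J = - (J ** A)"
    by (simp add: transpose_sp(1)[OF assms(3)])
  also have "trace (transpose \<Gamma> ** (- (J ** A) ** B)) = \<Gamma> \<bullet> (- (J ** A) ** B)"
    by (simp only: inner_Euc_eq_inner[symmetric] inner_Euc_def)
  also have "\<dots> = - (\<Gamma> \<bullet> (J ** (A ** B)))"
    by (simp add: matmul_simps)
  also have "\<dots> = - (\<Gamma> \<bullet> (J ** Z_term A B))"
    using antisym_inner_sp[OF assms(1) lie_conn_sp[OF assms(3,4)]]
    by (simp add: Z_term_eq matmul.diff_right inner_diff_right)
  \<comment> \<open>Transposing \<open>J\<close> in M^T J M = J reintroduces \<open>M\<close> and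
    absorbs the minus sign.\<close>
  also have "\<dots> = \<Gamma> \<bullet> (transpose M ** transpose J ** M ** Z_term A B)"
    by (simp add: matmul_simps M)
  also have "\<dots> = inner_Euc (J ** M ** \<Gamma>) (M ** Z_term A B)"
    by (simp add: inner_Euc_eq_inner matmul_inner_left transpose_simps matmul_simps)
  finally show ?thesis .
qed

text \<open>The second summand in the definition is minus the transpose of the first.\<close>

lemma transpose_Gamma_tilde: "transpose (Gamma_tilde G M) = - Gamma_tilde G M"
  by (simp add: Gamma_tilde_def transpose_simps matmul_simps scaleR_add_right)

theorem theorem3p6:
  fixes Gt G :: "'n::finite mat2n \<Rightarrow> real"
    and M X\<^sub>M Y\<^sub>M X\<^sub>0 Y\<^sub>0 S\<^sub>X S\<^sub>Y :: "'n mat2n"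
  assumes "smooth_on Sp Gt"
    and "smooth_on Gl G"
    and "\<forall>N\<in>Sp. G N = Gt N"
    and "M \<in> Sp"
    and "X\<^sub>M \<in> T_Sp M" and "Y\<^sub>M \<in> T_Sp M"
    and "S\<^sub>X \<in> Sym" and "S\<^sub>Y \<in> Sym"
    and "X\<^sub>M = M ** X\<^sub>0" and "X\<^sub>M = M ** J ** S\<^sub>X"
    and "Y\<^sub>M = M ** Y\<^sub>0" and "Y\<^sub>M = M ** J ** S\<^sub>Y"
  shows "Hess_Inv Gt M X\<^sub>M Y\<^sub>M =
     (Hess_Euc G M X\<^sub>M Y\<^sub>M - kron_form (Gamma_tilde G M) J X\<^sub>M Y\<^sub>M)
     + inner_Euc (grad_Euc G M + J ** M ** Gamma_tilde G M) (M ** Z_term X\<^sub>0 Y\<^sub>0)"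
proof -
  \<comment> \<open>Tangency gives M X = M C for some C in \<open>sp\<close>; cancelling
    \<open>M\<close> places \<open>X\<^sub>0\<close> and \<open>Y\<^sub>0\<close> themselves in
    \<open>sp\<close>.\<close>
  have cancel: "A = B" if "M ** A = M ** B" for A B
    using that sp_inv_cancel(1)[OF assms(4)] by metis
  have sp: "X\<^sub>0 \<in> sp" "Y\<^sub>0 \<in> sp"
    using assms(5,6) cancel by (auto simp: T_Sp_eq assms(9,11))
  have "Hess_Inv Gt M X\<^sub>M Y\<^sub>M =
      Hess_Euc G M X\<^sub>M Y\<^sub>M + inner_Euc (grad_Euc G M) (M ** Z_term X\<^sub>0 Y\<^sub>0)"
    unfolding assms(9,11)
    using Hess_Inv_left_invariant[OF assms(2) _ assms(4) sp] assms(3)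
    by (simp add: inner_Euc_eq_inner Z_term_eq)
  then show ?thesis
    using kron_form_eq_inner_Z_term[OF transpose_Gamma_tilde assms(4) sp, of G M]
    by (simp add: assms(9,11) inner_Euc_eq_inner inner_add_left)
qed

end
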